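(* Let $(a_n)_{n=1}^\infty$ be a sequence of positive integers satisfying \[ \frac{2}{3}\leq \frac{a_n^2}{a_{n+1}}\leq \frac{4}{3}\ \text{ for all } n\geq 1,\qquad \sum_{n=1}^\infty\frac{1}{a_n} = 1. \] Then $a_n=s_n$ for all $n\geq 1$, where $(s_n)_{n=1}^\infty$ is the Sylvester sequence.
   Context: The (shifted) Sylvester sequence $(s_n)_{n=1}^\infty$ is defined by $s_1=2$ and $s_{n+1}=s_n^2-s_n+1$ for $n\ge 1$. *)

theory Defs
  imports Complex_Main
begin

(* The sequence is indexed from 1; the value at index 0 is a dummy.
   The subtraction on nat never truncates, since x \<le> x^2. *)
fun sylvester :: "nat \<Rightarrow> nat" where
  "sylvester 0 = 0"
| "sylvester (Suc 0) = 2"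
| "sylvester (Suc (Suc n)) = sylvester (Suc n) ^ 2 - sylvester (Suc n) + 1"

end

theory Submission
  imports Defs
begin

text \<open>
  The reciprocals of the first \<open>m\<close> Sylvester numbers sum to \<open>1 - 1 / (s - 1)\<close>, where \<open>s\<close> is the
  next one. So if \<open>a\<close> agrees with the Sylvester sequence up to index \<open>m\<close>, the rest of the series
  sums to \<open>1 / (s - 1)\<close>, which forces the next term \<open>x\<close> to be at least \<open>s\<close>. On the other hand
  \<open>a (n + 1) \<ge> 3/4 * (a n)^2\<close> makes the series from \<open>x\<close> on sum to at most \<open>1 / (x - 3/2)\<close> when
  \<open>x \<ge> 3\<close>, so \<open>x \<ge> s + 1\<close> is impossible.
\<close>

lemma sylvester_ge_2: "sylvester (Suc n) \<ge> 2"
proof (induction n)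
  case (Suc n)
  then have "2 * sylvester (Suc n) \<le> sylvester (Suc n) ^ 2"
    by (simp add: power2_eq_square)
  with Suc show ?case by simp
qed simp

lemma sylvester_rec_real:
  "real (sylvester (Suc (Suc n))) - 1
    = real (sylvester (Suc n)) * (real (sylvester (Suc n)) - 1)"
proof -
  have "sylvester (Suc n) \<le> sylvester (Suc n) ^ 2"
    by (simp add: power2_eq_square)
  then show ?thesis
    by (simp add: of_nat_diff power2_eq_square algebra_simps)
qed

text \<open>Telescoping: \<open>1 / (s - 1) - 1 / s = 1 / (s * (s - 1))\<close>, and
  \<open>s * (s - 1)\<close> is the next Sylvester number minus 1.\<close>

lemma sum_inverse_sylvester:
  "(\<Sum>k<n. 1 / real (sylvester (Suc k))) = 1 - 1 / (real (sylvester (Suc n)) - 1)"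
proof (induction n)
  case (Suc n)
  define s where "s = real (sylvester (Suc n))"
  have "s \<ge> 2"
    using sylvester_ge_2[of n] by (simp add: s_def)
  then have "1 - 1 / (s - 1) + 1 / s = 1 - 1 / (s * (s - 1))"
    by (simp add: field_simps)
  with Suc show ?case
    by (simp only: sum.lessThan_Suc sylvester_rec_real flip: s_def)
qed simp

text \<open>For a shift c in place of 3/2, the case \<open>y = 3/4 * x^2\<close> with large
  \<open>x\<close> forces c >= 4/3, while excluding a first tail term of at least
  \<open>s + 1\<close> takes c < 2; 3/2 lies in between.\<close>

lemma potential_step:
  fixes x y :: real
  assumes "x \<ge> 3" "3 / 4 * x\<^sup>2 \<le> y"
  shows "1 / x + 1 / (y - 3/2) \<le> 1 / (x - 3/2)"
proof -
  have "3 * x \<le> x\<^sup>2"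
    using assms by (simp add: power2_eq_square)
  with assms have "x\<^sup>2 - 3/2 * x \<le> 3/2 * (y - 3/2)" and y: "y > 3/2"
    by (simp_all add: field_simps)
  then have "x * (x - 3/2) \<le> 3/2 * (y - 3/2)"
    by (simp add: power2_eq_square right_diff_distrib mult.commute)
  moreover have "x * (x - 3/2) > 0"
    using assms by simp
  ultimately have "1 / (y - 3/2) \<le> 3/2 / (x * (x - 3/2))"
    using y by (simp add: field_simps)
  also have "\<dots> = 1 / (x - 3/2) - 1 / x"
    using assms by (simp add: field_simps)
  finally show ?thesis by simp
qed

lemma sum_inverse_le_potential:
  fixes x :: "nat \<Rightarrow> real"
  assumes "x 0 \<ge> 3" "\<And>n. 3 / 4 * (x n)\<^sup>2 \<le> x (Suc n)"
  shows "(\<Sum>k<n. 1 / x k) \<le> 1 / (x 0 - 3/2)"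
proof -
  have ge3: "x n \<ge> 3" for n
  proof (induction n)
    case (Suc n)
    then have "3 * 3 \<le> x n * x n"
      by (intro mult_mono) auto
    with assms(2)[of n] show ?case
      by (simp add: power2_eq_square)
  qed (fact assms(1))
  \<comment> \<open>Partial sum plus potential is nonincreasing in \<open>n\<close> and equals the
    bound at \<open>n = 0\<close>.\<close>
  have "(\<Sum>k<n. 1 / x k) + 1 / (x n - 3/2) \<le> 1 / (x 0 - 3/2)"
  proof (induction n)
    case (Suc n)
    with potential_step[OF ge3[of n] assms(2)[of n]] show ?case by simp
  qed simp
  moreover have "1 / (x n - 3/2) \<ge> 0"
    using ge3[of n] by simp
  ultimately show ?thesis by linarith
qed

theorem corollary2:
  fixes a :: "nat \<Rightarrow> nat"
  assumes "\<forall>n\<ge>1. a n > 0"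
    and "\<forall>n\<ge>1. 2 / 3 \<le> (real (a n))\<^sup>2 / real (a (n + 1))
                \<and> (real (a n))\<^sup>2 / real (a (n + 1)) \<le> 4 / 3"
    and "(\<lambda>n. 1 / real (a (Suc n))) sums 1"
  shows "\<forall>n\<ge>1. a n = sylvester n"
proof -
  have pos: "a (Suc n) > 0" for n
    using assms(1) by simp
  have growth: "3 / 4 * (real (a (Suc n)))\<^sup>2 \<le> real (a (Suc (Suc n)))" for n
  proof -
    have "(real (a (Suc n)))\<^sup>2 / real (a (Suc (Suc n))) \<le> 4 / 3"
      using assms(2)[rule_format, of "Suc n"] by simp
    then show ?thesis
      using pos[of "Suc n"] by (simp add: field_simps)
  qed
  have "a (Suc m) = sylvester (Suc m)" for m
  proof (induction m rule: less_induct)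
    case (less m)
    define s where "s = sylvester (Suc m)"
    have s: "s \<ge> 2"
      unfolding s_def by (rule sylvester_ge_2)
    have "(\<Sum>k<m. 1 / real (a (Suc k))) = 1 - 1 / (real s - 1)"
      using less sum_inverse_sylvester[of m] by (simp add: s_def)
    then have tail: "(\<lambda>k. 1 / real (a (Suc (k + m)))) sums (1 / (real s - 1))"
      using assms(3) sums_iff_shift[of "\<lambda>n. 1 / real (a (Suc n))" m "1 / (real s - 1)"] by simp
    \<comment> \<open>The later terms are positive, so the inequality is strict; integrality then
      lifts \<open>a (Suc m) > s - 1\<close> to \<open>a (Suc m) \<ge> s\<close>.\<close>
    have "1 / real (a (Suc m)) < 1 / (real s - 1)"
      using sum_less_suminf[OF sums_summable[OF tail], of 1] pos sums_unique[OF tail] by simp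
    then have "real s - 1 < real (a (Suc m))"
      using s pos[of m] by (simp add: field_simps)
    then have "s \<le> a (Suc m)"
      by linarith
    moreover have "a (Suc m) \<le> s"
    proof (rule ccontr)
      assume "\<not> a (Suc m) \<le> s"
      then have gt: "real s + 1 \<le> real (a (Suc m))"
        by linarith
      \<comment> \<open>\<open>s \<ge> 2\<close> makes the first term at least 3, where the
        potential bound starts to apply.\<close>
      have "(\<Sum>k<n. 1 / real (a (Suc (k + m)))) \<le> 1 / (real (a (Suc m)) - 3/2)" for n
        using sum_inverse_le_potential[of "\<lambda>k. real (a (Suc (k + m)))" n] gt s growth by simp
      then have "1 / (real s - 1) \<le> 1 / (real (a (Suc m)) - 3/2)"
        using tail unfolding sums_def by (intro LIMSEQ_le_const2) auto
      \<comment> \<open>\<open>a (Suc m) - 3/2 \<ge> s - 1/2 > s - 1\<close>, so the tail would be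
        too small.\<close>
      then show False
        using gt s by (simp add: field_simps)
    qed
    ultimately show ?case
      by (simp add: s_def)
  qed
  then show ?thesis
    by (metis Suc_le_D One_nat_def)
qed

end
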